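(* There exist universal constants $0<c\le C<\infty$ such that for all $n,m\in\mathbb{N}$ and all $a_{i,j}\in\mathbb{R}$, $1\le i\le n$, $1\le j\le m$, setting $$ Q:=\max\Big\{\sum_{i=1}^n\Big(\sum_{j=1}^m a_{i,j}^2\Big)^{1/2},\ \sum_{j=1}^m\Big(\sum_{i=1}^n a_{i,j}^2\Big)^{1/2}\Big\}, $$ both of the quantities $\mathrm{disc}(K_{n,m},\{a_{i,j}\})$ and $\mathsf{E}_\theta\,\mathrm{disc}(K_{n,m},\{a_{i,j}\},\theta)$ lie between $cQ$ and $CQ$.
   Context: $K_{n,m}$ is the complete bipartite graph with parts $\{v_1,\dots,v_n\}$ and $\{u_1,\dots,u_m\}$, and the weight $a_{i,j}$ is assigned to the edge $(v_i,u_j)$. For an edge-coloring $\theta=(\theta_{i,j})_{i\le n,j\le m}$, $\theta_{i,j}\in\{-1,1\}$, the discrepancy with respect to $\theta$ is $$\mathrm{disc}(K_{n,m},\{a_{i,j}\},\theta):=\max\Big\{\Big|\sum_{i\in I,\,j\in J}\theta_{i,j}a_{i,j}\Big|:\ I\subset\{1,\dots,n\},\ J\subset\{1,\dots,m\}\Big\},$$ and $\mathrm{disc}(K_{n,m},\{a_{i,j}\}):=\min_\theta\mathrm{disc}(K_{n,m},\{a_{i,j}\},\theta)$. $\mathsf{E}_\theta$ denotes the expectation (uniform average) over all edge-colorings $\theta$. *)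

theory Defs
  imports "HOL-Probability.Probability"
begin

text \<open>
  The edge \<open>(v\<^sub>i, u\<^sub>j)\<close> of \<open>K\<^bsub>n,m\<^esub>\<close> is the index pair \<open>(i, j)\<close>. Colorings are extensional
  functions (\<open>undefined\<close> off the edge set), so that there are exactly \<open>2 ^ (n * m)\<close> of them.
\<close>

definition colorings :: "nat \<Rightarrow> nat \<Rightarrow> (nat \<times> nat \<Rightarrow> real) set" where
  "colorings n m = ({1..n} \<times> {1..m}) \<rightarrow>\<^sub>E {-1, 1}"

definition disc_col :: "nat \<Rightarrow> nat \<Rightarrow> (nat \<Rightarrow> nat \<Rightarrow> real) \<Rightarrow> (nat \<times> nat \<Rightarrow> real) \<Rightarrow> real" where
  "disc_col n m a \<theta> =
     Max {\<bar>\<Sum>i\<in>I. \<Sum>j\<in>J. \<theta> (i, j) * a i j\<bar> | I J. I \<subseteq> {1..n} \<and> J \<subseteq> {1..m}}"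

definition disc :: "nat \<Rightarrow> nat \<Rightarrow> (nat \<Rightarrow> nat \<Rightarrow> real) \<Rightarrow> real" where
  "disc n m a = Min (disc_col n m a ` colorings n m)"

definition expected_disc :: "nat \<Rightarrow> nat \<Rightarrow> (nat \<Rightarrow> nat \<Rightarrow> real) \<Rightarrow> real" where
  "expected_disc n m a = measure_pmf.expectation (pmf_of_set (colorings n m)) (disc_col n m a)"

text \<open>The maximum, the minimum and the uniform distribution above range over finite nonempty sets.\<close>

lemma finite_colorings: "finite (colorings n m)"
  by (simp add: colorings_def finite_PiE)

lemma colorings_nonempty: "colorings n m \<noteq> {}"
  by (simp add: colorings_def PiE_eq_empty_iff)

lemma card_colorings: "card (colorings n m) = 2 ^ (n * m)"
  by (simp add: colorings_def card_PiE card_cartesian_product numeral_2_eq_2)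

lemma finite_disc_col_set:
  "finite {\<bar>\<Sum>i\<in>I. \<Sum>j\<in>J. \<theta> (i, j) * a i j :: real\<bar> | I J. I \<subseteq> {1..n::nat} \<and> J \<subseteq> {1..m::nat}}"
proof -
  have "{\<bar>\<Sum>i\<in>I. \<Sum>j\<in>J. \<theta> (i, j) * a i j\<bar> | I J. I \<subseteq> {1..n} \<and> J \<subseteq> {1..m}}
      = (\<lambda>(I, J). \<bar>\<Sum>i\<in>I. \<Sum>j\<in>J. \<theta> (i, j) * a i j\<bar>) ` (Pow {1..n} \<times> Pow {1..m})"
    by auto
  then show ?thesis by simp
qed

lemma disc_col_set_nonempty:
  "{\<bar>\<Sum>i\<in>I. \<Sum>j\<in>J. \<theta> (i, j) * a i j :: real\<bar> | I J. I \<subseteq> {1..n::nat} \<and> J \<subseteq> {1..m::nat}} \<noteq> {}"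
  by blast

lemma expected_disc_eq_average:
  "expected_disc n m a = (\<Sum>\<theta>\<in>colorings n m. disc_col n m a \<theta>) / 2 ^ (n * m)"
  by (simp add: expected_disc_def integral_pmf_of_set finite_colorings colorings_nonempty
      card_colorings)

end

theory Submission
  imports Defs
begin

text \<open>
  Write \<open>r\<^sub>i\<close> and \<open>c\<^sub>j\<close> for the Euclidean norms of the rows and columns of the weight matrix, so that
  \<open>Q = max (\<Sum> r\<^sub>i) (\<Sum> c\<^sub>j)\<close>. The minimum over colorings is at most their average, so it suffices
  to bound the discrepancy of every coloring from below and the average discrepancy from above.

  Lower bound. A coloring does not change the norms of rows and columns, so let \<open>w\<close> be the
  weight matrix with the signs of the coloring included. For random column signs
  \<open>\<epsilon>\<close>, Khintchine's inequality \<open>khintchine_L1\<close> gives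
  \<open>E \<bar>\<Sum>\<^sub>j \<epsilon>\<^sub>j w\<^sub>i\<^sub>j\<bar> \<ge> (9/16) r\<^sub>i\<close>; hence some fixed signs make the sum of these absolute values over
  all rows at least \<open>(9/16) \<Sum> r\<^sub>i\<close>. Splitting the columns by the sign \<open>\<epsilon>\<^sub>j\<close> and the rows by the sign of the row
  sum leaves four rectangles, one of which carries a quarter of this. Transposing handles the columns
  (\<open>sum_row_norms_le_cut\<close>).

  Upper bound. The maximum of sign sums over the parts that \<open>2\<^sup>N\<close> rectangles cut out of a set of edges
  of total square weight \<open>V\<close> is on average at most of order \<open>t N + V / t\<close>, for every \<open>t > 0\<close>
  (\<open>sign_mean_Max_le\<close>). Using this for the whole matrix at once is too lossy, because rows of very
  different size need different \<open>t\<close>. So the edges are split into dyadic shells according to the size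
  of \<open>min r\<^sub>i c\<^sub>j\<close>, and the shell with \<open>t \<le> min r\<^sub>i c\<^sub>j < 2 t\<close> is treated with that same \<open>t\<close>. Only the rows with
  \<open>r\<^sub>i \<ge> t\<close> and the columns with \<open>c\<^sub>j \<ge> t\<close> meet this shell, and both error terms then sum to a
  multiple of \<open>\<Sum> r\<^sub>i + \<Sum> c\<^sub>j\<close>: the terms \<open>t N\<close> because every row and every column contributes a
  geometric series of powers of two below its norm, and the terms \<open>V / t\<close> because
  \<open>a\<^sub>i\<^sub>j\<^sup>2 / min r\<^sub>i c\<^sub>j \<le> a\<^sub>i\<^sub>j\<^sup>2 / r\<^sub>i + a\<^sub>i\<^sub>j\<^sup>2 / c\<^sub>j\<close>, whose sum over all edges is exactly \<open>\<Sum> r\<^sub>i + \<Sum> c\<^sub>j\<close>.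
  This is \<open>expected_cut_le\<close>.
\<close>

section \<open>Averages over sign patterns\<close>

definition sign_mean :: "'e set \<Rightarrow> (('e \<Rightarrow> real) \<Rightarrow> real) \<Rightarrow> real" where
  "sign_mean E f = (\<Sum>\<epsilon>\<in>E \<rightarrow>\<^sub>E {-1, 1}. f \<epsilon>) / 2 ^ card E"

lemma sign_mean_empty [simp]: "sign_mean {} f = f (\<lambda>_. undefined)"
  by (simp add: sign_mean_def)

lemma card_sign_patterns: "finite E \<Longrightarrow> card (E \<rightarrow>\<^sub>E {-1, 1 :: real}) = 2 ^ card E"
  by (simp add: card_PiE numeral_2_eq_2)

lemma sign_mean_const [simp]: "finite E \<Longrightarrow> sign_mean E (\<lambda>_. c) = c"
  by (simp add: sign_mean_def card_sign_patterns)

lemma sign_mean_mono: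
  assumes "\<And>\<epsilon>. \<epsilon> \<in> E \<rightarrow>\<^sub>E {-1, 1} \<Longrightarrow> f \<epsilon> \<le> g \<epsilon>"
  shows "sign_mean E f \<le> sign_mean E g"
  unfolding sign_mean_def by (intro divide_right_mono sum_mono assms) auto

lemma sign_mean_add: "sign_mean E (\<lambda>\<epsilon>. f \<epsilon> + g \<epsilon>) = sign_mean E f + sign_mean E g"
  by (simp add: sign_mean_def sum.distrib add_divide_distrib)

lemma sign_mean_cmult: "sign_mean E (\<lambda>\<epsilon>. c * f \<epsilon>) = c * sign_mean E f"
  by (simp add: sign_mean_def sum_distrib_left)

lemma sign_mean_sum: "sign_mean E (\<lambda>\<epsilon>. \<Sum>k\<in>K. f k \<epsilon>) = (\<Sum>k\<in>K. sign_mean E (f k))"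
  unfolding sign_mean_def by (subst sum.swap) (simp add: sum_divide_distrib)

lemma exists_ge_sign_mean:
  assumes "finite E"
  obtains \<epsilon> where "\<epsilon> \<in> E \<rightarrow>\<^sub>E {-1, 1}" "sign_mean E f \<le> f \<epsilon>"
proof -
  have "\<exists>\<epsilon>\<in>E \<rightarrow>\<^sub>E {-1, 1}. sign_mean E f \<le> f \<epsilon>"
  proof (rule ccontr)
    assume "\<not> ?thesis"
    then have "(\<Sum>\<epsilon>\<in>E \<rightarrow>\<^sub>E {-1, 1}. f \<epsilon>) < (\<Sum>\<epsilon>\<in>E \<rightarrow>\<^sub>E {-1, 1 :: real}. sign_mean E f)"
      using assms by (intro sum_strict_mono) (auto simp: finite_PiE PiE_eq_empty_iff not_le)
    also have "\<dots> = (\<Sum>\<epsilon>\<in>E \<rightarrow>\<^sub>E {-1, 1}. f \<epsilon>)"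
      using assms by (simp add: card_sign_patterns) (simp add: sign_mean_def)
    finally show False by simp
  qed
  then show ?thesis using that by blast
qed

text \<open>
  Averaging out one sign at a time: this recursion yields every moment below by induction
  on the index set, in place of an appeal to independence.
\<close>

lemma sign_mean_insert:
  assumes "finite E" "x \<notin> E"
  shows "sign_mean (insert x E) f = sign_mean E (\<lambda>\<epsilon>. (f (\<epsilon>(x := -1)) + f (\<epsilon>(x := 1))) / 2)"
proof -
  have "(\<Sum>\<epsilon>\<in>insert x E \<rightarrow>\<^sub>E {-1, 1}. f \<epsilon>)
      = (\<Sum>(s, \<epsilon>)\<in>{-1, 1 :: real} \<times> (E \<rightarrow>\<^sub>E {-1, 1}). f (\<epsilon>(x := s)))"
    unfolding PiE_insert_eq
    by (subst sum.reindex[OF inj_combinator[OF assms(2)]]) (simp add: case_prod_beta o_def)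
  also have "\<dots> = (\<Sum>\<epsilon>\<in>E \<rightarrow>\<^sub>E {-1, 1 :: real}. f (\<epsilon>(x := -1)) + f (\<epsilon>(x := 1)))"
    by (simp add: sum.cartesian_product[symmetric] sum.distrib)
  finally show ?thesis
    using assms by (simp add: sign_mean_def sum_divide_distrib)
qed

definition sign_sum :: "'e set \<Rightarrow> ('e \<Rightarrow> real) \<Rightarrow> ('e \<Rightarrow> real) \<Rightarrow> real" where
  "sign_sum E b \<epsilon> = (\<Sum>e\<in>E. \<epsilon> e * b e)"

lemma sign_sum_insert:
  assumes "finite E" "x \<notin> E"
  shows "sign_sum (insert x E) b (\<epsilon>(x := s)) = sign_sum E b \<epsilon> + s * b x"
proof -
  have "(\<Sum>e\<in>E. (\<epsilon>(x := s)) e * b e) = (\<Sum>e\<in>E. \<epsilon> e * b e)"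
    using assms(2) by (intro sum.cong) auto
  then show ?thesis using assms by (simp add: sign_sum_def)
qed

lemma sign_mean_square:
  assumes "finite E"
  shows "sign_mean E (\<lambda>\<epsilon>. (sign_sum E b \<epsilon>)\<^sup>2) = (\<Sum>e\<in>E. (b e)\<^sup>2)"
  using assms
proof induction
  case (insert x E)
  have "((s + -1 * b x)\<^sup>2 + (s + 1 * b x)\<^sup>2) / 2 = s\<^sup>2 + (b x)\<^sup>2" for s
    by (simp add: power2_eq_square algebra_simps)
  then show ?case
    using insert
    by (simp only: sign_mean_insert[OF insert.hyps] sign_sum_insert[OF insert.hyps] sign_mean_add) simp
qed (simp add: sign_sum_def)

text \<open>
  The factor \<open>3\<close> survives the induction because a new coefficient \<open>y\<close> adds \<open>6 y\<^sup>2 V + y\<^sup>4\<close> to the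
  fourth moment, while \<open>3 (V + y\<^sup>2)\<^sup>2\<close> exceeds \<open>3 V\<^sup>2\<close> by \<open>6 y\<^sup>2 V + 3 y\<^sup>4\<close>.
\<close>

lemma sign_mean_fourth_power:
  assumes "finite E"
  shows "sign_mean E (\<lambda>\<epsilon>. (sign_sum E b \<epsilon>) ^ 4) \<le> 3 * (\<Sum>e\<in>E. (b e)\<^sup>2)\<^sup>2"
  using assms
proof induction
  case (insert x E)
  let ?V = "\<Sum>e\<in>E. (b e)\<^sup>2"
  have "((s + -1 * b x) ^ 4 + (s + 1 * b x) ^ 4) / 2 = s ^ 4 + (6 * (b x)\<^sup>2 * s\<^sup>2 + (b x) ^ 4)" for s
    by (simp add: power2_eq_square power4_eq_xxxx algebra_simps)
  then have "sign_mean (insert x E) (\<lambda>\<epsilon>. (sign_sum (insert x E) b \<epsilon>) ^ 4)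
      = sign_mean E (\<lambda>\<epsilon>. (sign_sum E b \<epsilon>) ^ 4) + (6 * (b x)\<^sup>2 * ?V + (b x) ^ 4)"
    by (simp only: sign_mean_insert[OF insert.hyps] sign_sum_insert[OF insert.hyps] sign_mean_add
        sign_mean_cmult sign_mean_square[OF insert.hyps(1)] sign_mean_const[OF insert.hyps(1)])
  also have "\<dots> \<le> 3 * ?V\<^sup>2 + (6 * (b x)\<^sup>2 * ?V + 3 * (b x) ^ 4)"
  proof -
    have "0 \<le> (b x) ^ 4" by simp
    with insert.IH show ?thesis by linarith
  qed
  also have "\<dots> = 3 * ((b x)\<^sup>2 + ?V)\<^sup>2"
    by (simp add: power2_sum power_mult_distrib algebra_simps flip: power_mult)
  finally show ?case using insert.hyps by simp
qed (simp add: sign_sum_def)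

text \<open>
  This is Hoeffding's lemma for a fair sign: its logarithmic form at \<open>h = 2 x\<close>, \<open>p = 1/2\<close>
  reads \<open>ln (cosh x) \<le> x\<^sup>2 / 2\<close>.
\<close>

lemma cosh_le_exp_half_square: "cosh x \<le> exp (x\<^sup>2 / 2)" for x :: real
proof -
  have "cosh x \<le> exp (x\<^sup>2 / 2)" if "x \<ge> 0" for x :: real
  proof -
    have eq: "1 + 1 / 2 * (exp (2 * x) - 1) = exp x * cosh x"
      by (simp add: cosh_def algebra_simps flip: exp_add)
    have "- x + ln (exp x * cosh x) \<le> (2 * x)\<^sup>2 / 8"
      using Hoeffdings_lemma_aux[of "2 * x" "1 / 2"] that unfolding eq by simp
    then have "ln (cosh x) \<le> x\<^sup>2 / 2"
      using cosh_real_pos[of x] by (simp add: ln_mult power_mult_distrib)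
    then show ?thesis
      using cosh_real_pos[of x] by (metis exp_le_cancel_iff exp_ln)
  qed
  from this[of "\<bar>x\<bar>"] show ?thesis by (cases "x \<ge> 0") auto
qed

lemma sign_mean_exp_le:
  assumes "finite E"
  shows "sign_mean E (\<lambda>\<epsilon>. exp (sign_sum E b \<epsilon>)) \<le> exp ((\<Sum>e\<in>E. (b e)\<^sup>2) / 2)"
  using assms
proof induction
  case (insert x E)
  have "(exp (s + -1 * b x) + exp (s + 1 * b x)) / 2 = cosh (b x) * exp s" for s
    by (simp add: cosh_def exp_add exp_diff exp_minus field_simps)
  then have "sign_mean (insert x E) (\<lambda>\<epsilon>. exp (sign_sum (insert x E) b \<epsilon>))
      = cosh (b x) * sign_mean E (\<lambda>\<epsilon>. exp (sign_sum E b \<epsilon>))"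
    by (simp only: sign_mean_insert[OF insert.hyps] sign_sum_insert[OF insert.hyps] sign_mean_cmult)
  also have "\<dots> \<le> cosh (b x) * exp ((\<Sum>e\<in>E. (b e)\<^sup>2) / 2)"
    using insert.IH cosh_real_nonneg[of "b x"] by (rule mult_left_mono)
  also have "\<dots> \<le> exp ((b x)\<^sup>2 / 2) * exp ((\<Sum>e\<in>E. (b e)\<^sup>2) / 2)"
    using cosh_le_exp_half_square[of "b x"] by (intro mult_right_mono) auto
  also have "\<dots> = exp ((\<Sum>e\<in>insert x E. (b e)\<^sup>2) / 2)"
    using insert.hyps by (simp add: add_divide_distrib flip: exp_add)
  finally show ?case .
qed (simp add: sign_sum_def)

section \<open>The lower bound\<close>

text \<open>
  Khintchine's inequality between the first and the second moment. The first moment is bounded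
  from below by a combination of the second and fourth ones: with \<open>u = \<bar>s\<bar> / \<sigma>\<close>, the polynomial
  \<open>u - (3/4 u\<^sup>2 - u\<^sup>4 / 16)\<close> factors as \<open>u (u - 2)\<^sup>2 (u + 4) / 16\<close> and is thus nonnegative,
  and the two moments give \<open>3/4 - 3/16 = 9/16\<close>.
\<close>

lemma khintchine_L1:
  assumes "finite E"
  shows "9 / 16 * sqrt (\<Sum>e\<in>E. (b e)\<^sup>2) \<le> sign_mean E (\<lambda>\<epsilon>. \<bar>sign_sum E b \<epsilon>\<bar>)"
proof -
  define \<sigma> where "\<sigma> = sqrt (\<Sum>e\<in>E. (b e)\<^sup>2)"
  have sq: "\<sigma>\<^sup>2 = (\<Sum>e\<in>E. (b e)\<^sup>2)"
    by (simp add: \<sigma>_def sum_nonneg)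
  have "\<sigma> \<ge> 0" by (simp add: \<sigma>_def sum_nonneg)
  show ?thesis
  proof (cases "\<sigma> = 0")
    case True
    have "sign_mean E (\<lambda>_. 0) \<le> sign_mean E (\<lambda>\<epsilon>. \<bar>sign_sum E b \<epsilon>\<bar>)"
      by (rule sign_mean_mono) simp
    with True assms show ?thesis unfolding \<sigma>_def by simp
  next
    case False
    with \<open>\<sigma> \<ge> 0\<close> have pos: "\<sigma> > 0" by simp
    have pointwise: "3 / (4 * \<sigma>) * s\<^sup>2 + (- 1 / (16 * \<sigma> ^ 3)) * s ^ 4 \<le> \<bar>s\<bar>" for s
    proof -
      define u where "u = \<bar>s\<bar> / \<sigma>"
      have u: "u \<ge> 0" "\<bar>s\<bar> = \<sigma> * u" using pos by (auto simp: u_def)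
      have s2: "s\<^sup>2 = \<sigma>\<^sup>2 * u\<^sup>2"
        using u(2) by (metis power2_abs power_mult_distrib)
      have s4: "s ^ 4 = \<sigma> ^ 4 * u ^ 4"
        using s2 by (metis (no_types, lifting) power_even_abs_numeral power_mult_distrib u(2) even_numeral)
      have "0 \<le> u * ((u - 2)\<^sup>2 * (u + 4)) / 16" using u by simp
      also have "\<dots> = u - (3 / 4 * u\<^sup>2 - u ^ 4 / 16)"
        by (simp add: power2_eq_square power4_eq_xxxx field_simps)
      finally have "3 / 4 * u\<^sup>2 - u ^ 4 / 16 \<le> u" by simp
      then have "\<sigma> * (3 / 4 * u\<^sup>2 - u ^ 4 / 16) \<le> \<sigma> * u"
        using pos by simp
      moreover have "3 / (4 * \<sigma>) * s\<^sup>2 + (- 1 / (16 * \<sigma> ^ 3)) * s ^ 4 = \<sigma> * (3 / 4 * u\<^sup>2 - u ^ 4 / 16)"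
        unfolding s2 s4 using pos
        by (simp add: field_simps power2_eq_square power3_eq_cube power4_eq_xxxx)
      ultimately show ?thesis using u(2) by simp
    qed
    let ?M4 = "sign_mean E (\<lambda>\<epsilon>. (sign_sum E b \<epsilon>) ^ 4)"
    have "?M4 \<le> 3 * (\<sigma>\<^sup>2)\<^sup>2"
      using sign_mean_fourth_power[OF assms, of b] sq by simp
    then have "(1 / (16 * \<sigma> ^ 3)) * ?M4 \<le> (1 / (16 * \<sigma> ^ 3)) * (3 * (\<sigma>\<^sup>2)\<^sup>2)"
      using pos by (intro mult_left_mono) auto
    also have "\<dots> = 3 / 16 * \<sigma>"
      using pos by (simp add: field_simps power2_eq_square power3_eq_cube)
    finally have M4: "(1 / (16 * \<sigma> ^ 3)) * ?M4 \<le> 3 / 16 * \<sigma>" .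
    have "9 / 16 * \<sigma> \<le> 3 / (4 * \<sigma>) * \<sigma>\<^sup>2 + (- 1 / (16 * \<sigma> ^ 3)) * ?M4"
      using M4 pos by (simp add: power2_eq_square)
    also have "\<dots> = sign_mean E
        (\<lambda>\<epsilon>. 3 / (4 * \<sigma>) * (sign_sum E b \<epsilon>)\<^sup>2 + (- 1 / (16 * \<sigma> ^ 3)) * (sign_sum E b \<epsilon>) ^ 4)"
      by (simp only: sign_mean_add sign_mean_cmult sign_mean_square[OF assms] sq)
    also have "\<dots> \<le> sign_mean E (\<lambda>\<epsilon>. \<bar>sign_sum E b \<epsilon>\<bar>)"
      by (rule sign_mean_mono) (rule pointwise)
    finally show ?thesis by (simp add: \<sigma>_def)
  qed
qed

text \<open>
  The constant is the \<open>9/16\<close> of Khintchine's inequality divided by four: once for the two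
  signs of the columns and once for the two signs of the row sums.
\<close>

lemma sum_row_norms_le_cut:
  fixes w :: "'a \<Rightarrow> 'b \<Rightarrow> real"
  assumes fin: "finite A" "finite B"
    and cut: "\<And>I J. I \<subseteq> A \<Longrightarrow> J \<subseteq> B \<Longrightarrow> \<bar>\<Sum>i\<in>I. \<Sum>j\<in>J. w i j\<bar> \<le> D"
  shows "9 / 64 * (\<Sum>i\<in>A. sqrt (\<Sum>j\<in>B. (w i j)\<^sup>2)) \<le> D"
proof -
  have rows: "(\<Sum>i\<in>A. \<bar>\<Sum>j\<in>J. w i j\<bar>) \<le> 2 * D" if "J \<subseteq> B" for J
  proof -
    \<comment> \<open>On \<open>P\<close> and on its complement the row sums have constant sign, so the sum of their absolute values
      over either part is the absolute value of a single cut.\<close>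
    define P where "P = {i\<in>A. (\<Sum>j\<in>J. w i j) \<ge> 0}"
    have "(\<Sum>i\<in>A. \<bar>\<Sum>j\<in>J. w i j\<bar>) = (\<Sum>i\<in>P. \<bar>\<Sum>j\<in>J. w i j\<bar>) + (\<Sum>i\<in>A - P. \<bar>\<Sum>j\<in>J. w i j\<bar>)"
      using fin(1) by (subst sum.subset_diff[of P A]) (auto simp: P_def)
    also have "(\<Sum>i\<in>P. \<bar>\<Sum>j\<in>J. w i j\<bar>) = (\<Sum>i\<in>P. \<Sum>j\<in>J. w i j)"
      by (intro sum.cong) (auto simp: P_def)
    also have "(\<Sum>i\<in>A - P. \<bar>\<Sum>j\<in>J. w i j\<bar>) = - (\<Sum>i\<in>A - P. \<Sum>j\<in>J. w i j)"
      unfolding sum_negf[symmetric, of _ "A - P"] by (intro sum.cong) (auto simp: P_def)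
    finally show ?thesis
      using cut[of P J] cut[of "A - P" J] that by (auto simp: P_def)
  qed
  have "9 / 16 * (\<Sum>i\<in>A. sqrt (\<Sum>j\<in>B. (w i j)\<^sup>2))
      \<le> (\<Sum>i\<in>A. sign_mean B (\<lambda>\<epsilon>. \<bar>sign_sum B (w i) \<epsilon>\<bar>))"
    unfolding sum_distrib_left by (intro sum_mono khintchine_L1 fin)
  also have "\<dots> = sign_mean B (\<lambda>\<epsilon>. \<Sum>i\<in>A. \<bar>sign_sum B (w i) \<epsilon>\<bar>)"
    by (simp add: sign_mean_sum)
  also obtain \<epsilon> where \<epsilon>: "\<epsilon> \<in> B \<rightarrow>\<^sub>E {-1, 1}"
    and "sign_mean B (\<lambda>\<epsilon>. \<Sum>i\<in>A. \<bar>sign_sum B (w i) \<epsilon>\<bar>) \<le> (\<Sum>i\<in>A. \<bar>sign_sum B (w i) \<epsilon>\<bar>)"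
    using exists_ge_sign_mean[OF fin(2)] .
  note this(2)
  also have "(\<Sum>i\<in>A. \<bar>sign_sum B (w i) \<epsilon>\<bar>) \<le> 4 * D"
  proof -
    define P where "P = {j\<in>B. \<epsilon> j = 1}"
    have "\<bar>sign_sum B (w i) \<epsilon>\<bar> \<le> \<bar>\<Sum>j\<in>P. w i j\<bar> + \<bar>\<Sum>j\<in>B - P. w i j\<bar>" for i
    proof -
      have "sign_sum B (w i) \<epsilon> = (\<Sum>j\<in>P. \<epsilon> j * w i j) + (\<Sum>j\<in>B - P. \<epsilon> j * w i j)"
        unfolding sign_sum_def using fin(2)
        by (subst sum.subset_diff[of P B]) (auto simp: P_def)
      also have "(\<Sum>j\<in>P. \<epsilon> j * w i j) = (\<Sum>j\<in>P. w i j)"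
        by (intro sum.cong) (auto simp: P_def)
      also have "(\<Sum>j\<in>B - P. \<epsilon> j * w i j) = - (\<Sum>j\<in>B - P. w i j)"
        unfolding sum_negf[symmetric, of _ "B - P"] using \<epsilon> by (intro sum.cong) (auto simp: P_def PiE_iff)
      finally show ?thesis by linarith
    qed
    then have "(\<Sum>i\<in>A. \<bar>sign_sum B (w i) \<epsilon>\<bar>)
        \<le> (\<Sum>i\<in>A. \<bar>\<Sum>j\<in>P. w i j\<bar>) + (\<Sum>i\<in>A. \<bar>\<Sum>j\<in>B - P. w i j\<bar>)"
      unfolding sum.distrib[symmetric] by (intro sum_mono)
    with rows[of P] rows[of "B - P"] show ?thesis by (auto simp: P_def)
  qed
  finally show ?thesis by simp
qed

lemma le_disc_col:
  assumes "I \<subseteq> {1..n}" "J \<subseteq> {1..m}"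
  shows "\<bar>\<Sum>i\<in>I. \<Sum>j\<in>J. \<theta> (i, j) * a i j\<bar> \<le> disc_col n m a \<theta>"
  unfolding disc_col_def using assms by (intro Max_ge finite_disc_col_set) auto

lemma disc_col_le:
  assumes "\<And>I J. I \<subseteq> {1..n} \<Longrightarrow> J \<subseteq> {1..m} \<Longrightarrow> \<bar>\<Sum>i\<in>I. \<Sum>j\<in>J. \<theta> (i, j) * a i j\<bar> \<le> D"
  shows "disc_col n m a \<theta> \<le> D"
  unfolding disc_col_def using assms by (subst Max_le_iff[OF finite_disc_col_set disc_col_set_nonempty]) auto

lemma disc_col_lower_bound:
  assumes "\<theta> \<in> colorings n m"
  shows "9 / 64 * max (\<Sum>i=1..n. sqrt (\<Sum>j=1..m. (a i j)\<^sup>2)) (\<Sum>j=1..m. sqrt (\<Sum>i=1..n. (a i j)\<^sup>2))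
    \<le> disc_col n m a \<theta>"
proof -
  have sq: "(\<theta> (i, j) * a i j)\<^sup>2 = (a i j)\<^sup>2" if "i \<in> {1..n}" "j \<in> {1..m}" for i j
  proof -
    have "\<theta> (i, j) \<in> {-1, 1}"
      using PiE_mem[OF assms[unfolded colorings_def], of "(i, j)"] that by simp
    then show ?thesis by auto
  qed
  have "9 / 64 * (\<Sum>i=1..n. sqrt (\<Sum>j=1..m. (\<theta> (i, j) * a i j)\<^sup>2)) \<le> disc_col n m a \<theta>"
    by (intro sum_row_norms_le_cut le_disc_col) auto
  moreover have "9 / 64 * (\<Sum>j=1..m. sqrt (\<Sum>i=1..n. (\<theta> (i, j) * a i j)\<^sup>2)) \<le> disc_col n m a \<theta>"
  proof (rule sum_row_norms_le_cut)
    fix J I assume "J \<subseteq> {1..m}" "I \<subseteq> {1..n}"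
    then show "\<bar>\<Sum>j\<in>J. \<Sum>i\<in>I. \<theta> (i, j) * a i j\<bar> \<le> disc_col n m a \<theta>"
      by (subst sum.swap) (rule le_disc_col)
  qed auto
  ultimately show ?thesis
    by (simp add: sq max_def)
qed

section \<open>The upper bound\<close>

text \<open>
  The maximal inequality for finitely many sign sums. The exponential moment of the maximum is
  at most the sum of the exponential moments of all \<open>\<plusminus> sign_sum X b\<close>, which is at most \<open>exp c\<close>
  for \<open>c = ln (2 * card \<F>) + V / (2 t\<^sup>2)\<close> when the sums are scaled by \<open>1 / t\<close>. Passing from the
  exponential moment back to the mean needs no more than the tangent line \<open>x \<le> c - 1 + exp (x - c)\<close>
  of the exponential function at \<open>c\<close>. The parameter \<open>t\<close> is left free,
  so that it can be matched to the size of the rows and columns involved.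
\<close>

lemma sign_mean_Max_le:
  fixes t :: real
  assumes "finite E" "L \<subseteq> E" "\<F> \<subseteq> Pow L" "\<F> \<noteq> {}" "t > 0"
  shows "sign_mean E (\<lambda>\<epsilon>. Max ((\<lambda>X. \<bar>sign_sum X b \<epsilon>\<bar>) ` \<F>))
    \<le> t * ln (2 * card \<F>) + (\<Sum>e\<in>L. (b e)\<^sup>2) / (2 * t)"
proof -
  have "finite L" using assms(1,2) finite_subset by blast
  then have fin: "finite \<F>" using assms(3) by (meson finite_Pow_iff finite_subset)
  define V where "V = (\<Sum>e\<in>L. (b e)\<^sup>2)"
  define c where "c = ln (2 * card \<F>) + V / (2 * t\<^sup>2)"
  have card_pos: "0 < card \<F>" using fin assms(4) by (simp add: card_gt_0_iff)
  have mgf: "sign_mean E (\<lambda>\<epsilon>. exp (r * sign_sum X b \<epsilon>)) \<le> exp (V / (2 * t\<^sup>2))"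
    if "X \<in> \<F>" and r: "r\<^sup>2 = 1 / t\<^sup>2" for X r
  proof -
    have X: "X \<subseteq> L" "X \<subseteq> E" using that assms by auto
    define d where "d = (\<lambda>e. if e \<in> X then r * b e else 0)"
    have "r * sign_sum X b \<epsilon> = sign_sum E d \<epsilon>" for \<epsilon>
    proof -
      have "sign_sum E d \<epsilon> = (\<Sum>e\<in>X. \<epsilon> e * d e)"
        unfolding sign_sum_def using assms(1) X by (intro sum.mono_neutral_right) (auto simp: d_def)
      then show ?thesis
        by (simp add: sign_sum_def d_def sum_distrib_left mult_ac cong: sum.cong)
    qed
    then have "sign_mean E (\<lambda>\<epsilon>. exp (r * sign_sum X b \<epsilon>)) \<le> exp ((\<Sum>e\<in>E. (d e)\<^sup>2) / 2)"
      using sign_mean_exp_le[OF assms(1), of d] by simp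
    also have "(\<Sum>e\<in>E. (d e)\<^sup>2) = (\<Sum>e\<in>X. (b e)\<^sup>2) / t\<^sup>2"
    proof -
      have "(\<Sum>e\<in>E. (d e)\<^sup>2) = (\<Sum>e\<in>X. (d e)\<^sup>2)"
        using assms(1) X by (intro sum.mono_neutral_right) (auto simp: d_def)
      also have "\<dots> = (\<Sum>e\<in>X. (b e)\<^sup>2 / t\<^sup>2)"
        by (intro sum.cong) (auto simp: d_def power_mult_distrib r)
      finally show ?thesis by (simp add: sum_divide_distrib)
    qed
    also have "exp ((\<Sum>e\<in>X. (b e)\<^sup>2) / t\<^sup>2 / 2) \<le> exp (V / (2 * t\<^sup>2))"
    proof -
      have "(\<Sum>e\<in>X. (b e)\<^sup>2) \<le> V"
        unfolding V_def using X \<open>finite L\<close> by (intro sum_mono2) auto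
      then show ?thesis by (simp add: divide_right_mono field_simps)
    qed
    finally show ?thesis .
  qed
  have pointwise: "Max ((\<lambda>X. \<bar>sign_sum X b \<epsilon>\<bar>) ` \<F>)
      \<le> t * (c - 1) + t * exp (- c) * (\<Sum>X\<in>\<F>. exp (1 / t * sign_sum X b \<epsilon>) + exp (- 1 / t * sign_sum X b \<epsilon>))"
    (is "_ \<le> ?rhs") for \<epsilon>
  proof -
    have "\<bar>sign_sum X b \<epsilon>\<bar> \<le> ?rhs" if "X \<in> \<F>" for X
    proof -
      let ?s = "sign_sum X b \<epsilon>"
      have "\<bar>?s\<bar> / t - c + 1 \<le> exp (\<bar>?s\<bar> / t - c)"
        using exp_ge_add_one_self[of "\<bar>?s\<bar> / t - c"] by linarith
      also have "\<dots> = exp (- c) * exp (\<bar>?s\<bar> / t)" by (simp flip: exp_add)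
      also have "exp (\<bar>?s\<bar> / t) \<le> exp (1 / t * ?s) + exp (- 1 / t * ?s)"
        by (cases "?s \<ge> 0") (auto simp: abs_if)
      also have "\<dots> \<le> (\<Sum>X\<in>\<F>. exp (1 / t * sign_sum X b \<epsilon>) + exp (- 1 / t * sign_sum X b \<epsilon>))"
        using fin that by (intro member_le_sum) (auto intro: add_nonneg_nonneg)
      finally have "\<bar>?s\<bar> / t \<le> c - 1
          + exp (- c) * (\<Sum>X\<in>\<F>. exp (1 / t * sign_sum X b \<epsilon>) + exp (- 1 / t * sign_sum X b \<epsilon>))"
        by simp
      then show ?thesis using assms(5) by (simp add: field_simps)
    qed
    then show ?thesis using fin assms(4) by simp
  qed
  have "sign_mean E (\<lambda>\<epsilon>. Max ((\<lambda>X. \<bar>sign_sum X b \<epsilon>\<bar>) ` \<F>))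
      \<le> sign_mean E (\<lambda>\<epsilon>. t * (c - 1) + t * exp (- c) *
          (\<Sum>X\<in>\<F>. exp (1 / t * sign_sum X b \<epsilon>) + exp (- 1 / t * sign_sum X b \<epsilon>)))"
    by (intro sign_mean_mono pointwise)
  also have "\<dots> = t * (c - 1) + t * exp (- c) *
      (\<Sum>X\<in>\<F>. sign_mean E (\<lambda>\<epsilon>. exp (1 / t * sign_sum X b \<epsilon>))
        + sign_mean E (\<lambda>\<epsilon>. exp (- 1 / t * sign_sum X b \<epsilon>)))"
    by (simp only: sign_mean_add sign_mean_cmult sign_mean_sum sign_mean_const[OF assms(1)])
  also have "\<dots> \<le> t * (c - 1) + t * exp (- c) * (\<Sum>X\<in>\<F>. exp (V / (2 * t\<^sup>2)) + exp (V / (2 * t\<^sup>2)))"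
    using assms(5) by (intro add_left_mono mult_left_mono sum_mono add_mono mgf)
      (auto simp: power_divide)
  also have "(\<Sum>X\<in>\<F>. exp (V / (2 * t\<^sup>2)) + exp (V / (2 * t\<^sup>2))) = exp c"
    using card_pos by (simp add: c_def exp_add)
  also have "t * (c - 1) + t * exp (- c) * exp c = t * c"
    by (simp add: exp_minus field_simps)
  also have "t * c = t * ln (2 * card \<F>) + V / (2 * t)"
    using assms(5) by (simp add: c_def field_simps power2_eq_square)
  finally show ?thesis by (simp add: V_def)
qed

lemma sum_powers_of_two_less:
  fixes K :: "int set" and b :: int
  assumes "finite K" "\<And>k. k \<in> K \<Longrightarrow> k < b"
  shows "(\<Sum>k\<in>K. 2 powr k) < 2 powr b"
  using assms
proof (induction K arbitrary: b rule: finite_linorder_max_induct)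
  case (insert k K)
  have "(\<Sum>l\<in>insert k K. 2 powr l) = 2 powr k + (\<Sum>l\<in>K. 2 powr l)"
    using insert.hyps by (subst sum.insert) auto
  also have "\<dots> < 2 powr k + 2 powr k"
    using insert.IH[of k] insert.hyps by simp
  also have "\<dots> = 2 powr (k + 1)" by (simp add: powr_add)
  also have "\<dots> \<le> 2 powr b"
  proof -
    have "k + 1 \<le> b" using insert.prems[of k] by simp
    then have "real_of_int k + 1 \<le> b" by linarith
    then show ?thesis by (intro powr_mono) auto
  qed
  finally show ?case .
qed simp

lemma sum_powers_of_two_le:
  fixes K :: "int set"
  assumes "finite K" "r \<ge> 0"
  shows "(\<Sum>k\<in>{k\<in>K. 2 powr k \<le> r}. 2 powr k) \<le> 2 * r"
proof (cases "r = 0")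
  case False
  with assms have r: "r > 0" by simp
  have "k < \<lfloor>log 2 r\<rfloor> + 1" if "2 powr k \<le> r" for k :: int
    using that r by (simp add: le_log_iff le_floor_iff)
  then have "(\<Sum>k\<in>{k\<in>K. 2 powr k \<le> r}. 2 powr k) < 2 powr (\<lfloor>log 2 r\<rfloor> + 1 :: int)"
    using assms by (intro sum_powers_of_two_less) auto
  also have "\<dots> = 2 * 2 powr (\<lfloor>log 2 r\<rfloor>)" by (simp add: powr_add)
  also have "\<dots> \<le> 2 * 2 powr (log 2 r)" by (intro mult_left_mono powr_mono) auto
  also have "\<dots> = 2 * r" using r by simp
  finally show ?thesis by simp
qed simp

text \<open>
  The cut of one shell depends only on the chosen subsets of \<open>R\<close> and \<open>C\<close>, so there are at most
  \<open>2 ^ (card R + card C)\<close> candidates for the maximum. The additional summand \<open>ln 2\<close>, which comes from the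
  absolute values, is absorbed since \<open>R\<close> is not empty.
\<close>

lemma sign_mean_dyadic_shell_le:
  fixes a :: "'a \<Rightarrow> 'b \<Rightarrow> real" and t :: real
  assumes fin: "finite A" "finite B" and R: "R \<subseteq> A" and C: "C \<subseteq> B"
    and L: "L \<subseteq> R \<times> C" "L \<noteq> {}" and t: "t > 0"
  shows "sign_mean (A \<times> B) (\<lambda>\<theta>. Max ((\<lambda>X. \<bar>sign_sum X (\<lambda>(i, j). a i j) \<theta>\<bar>) `
          ((\<lambda>(I, J). L \<inter> I \<times> J) ` (Pow R \<times> Pow C))))
    \<le> 2 * t * (card R + card C) + (\<Sum>(i, j)\<in>L. (a i j)\<^sup>2) / (2 * t)"
proof -
  let ?\<F> = "(\<lambda>(I, J). L \<inter> I \<times> J) ` (Pow R \<times> Pow C)"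
  let ?N = "card R + card C"
  have finRC: "finite R" "finite C" using R C fin finite_subset by blast+
  then have fin\<F>: "finite ?\<F>" by simp
  have ne: "?\<F> \<noteq> {}" by auto
  have "card ?\<F> \<le> card (Pow R \<times> Pow C)"
    using finRC by (intro card_image_le) auto
  also have "\<dots> = 2 ^ ?N"
    using finRC by (simp add: card_cartesian_product card_Pow power_add)
  finally have card: "real (card ?\<F>) \<le> 2 ^ ?N"
    by (metis of_nat_le_iff of_nat_numeral of_nat_power)
  have "R \<noteq> {}" using L by auto
  then have N: "1 \<le> ?N" using finRC by (simp add: Suc_le_eq card_gt_0_iff)
  have "0 < card ?\<F>" using fin\<F> ne by (simp only: card_gt_0_iff) simp
  then have "ln (2 * real (card ?\<F>)) \<le> ln (2 * 2 ^ ?N)"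
    using card by (subst ln_le_cancel_iff) auto
  also have "\<dots> = real (?N + 1) * ln 2"
    by (simp add: ln_mult ln_realpow algebra_simps)
  also have "\<dots> \<le> real (?N + 1) * 1"
    using ln_2_less_1 by (intro mult_left_mono) auto
  also have "\<dots> \<le> 2 * ?N" using N by simp
  finally have "t * ln (2 * real (card ?\<F>)) \<le> 2 * t * ?N"
    using t by simp
  moreover have "sign_mean (A \<times> B) (\<lambda>\<theta>. Max ((\<lambda>X. \<bar>sign_sum X (\<lambda>(i, j). a i j) \<theta>\<bar>) ` ?\<F>))
      \<le> t * ln (2 * card ?\<F>) + (\<Sum>e\<in>L. ((\<lambda>(i, j). a i j) e)\<^sup>2) / (2 * t)"
    using fin R C L t ne by (intro sign_mean_Max_le) auto
  ultimately show ?thesis by (simp add: case_prod_beta)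
qed

text \<open>
  Every index \<open>i\<close> is counted at those powers of two that do not exceed \<open>f i\<close>; these form
  part of a geometric progression with sum at most \<open>2 * f i\<close>.
\<close>

lemma sum_geometric_cards_le:
  assumes "finite A" "finite (K :: int set)" "\<And>i. i \<in> A \<Longrightarrow> f i \<ge> 0"
  shows "(\<Sum>k\<in>K. 2 powr k * card {i\<in>A. 2 powr k \<le> f i}) \<le> 2 * (\<Sum>i\<in>A. f i)"
proof -
  have "(\<Sum>k\<in>K. 2 powr k * card {i\<in>A. 2 powr k \<le> f i})
      = (\<Sum>k\<in>K. \<Sum>i\<in>{i\<in>A. 2 powr k \<le> f i}. 2 powr k)"
    by (simp add: mult.commute)
  also have "\<dots> = (\<Sum>i\<in>A. \<Sum>k\<in>{k\<in>K. 2 powr k \<le> f i}. 2 powr k)"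
    using assms by (intro sum.swap_restrict)
  also have "\<dots> \<le> (\<Sum>i\<in>A. 2 * f i)"
    using assms by (intro sum_mono sum_powers_of_two_le) auto
  finally show ?thesis by (simp add: sum_distrib_left)
qed

text \<open>
  The majorant \<open>M \<theta>\<close> of all cuts is the sum of the maximal cuts in the dyadic shells, so its
  average is the sum of the averages shell by shell. A pair of sets \<open>I\<close>, \<open>J\<close>
  cuts shell \<open>k\<close> in the same edges as \<open>I \<inter> R k\<close>, \<open>J \<inter> C k\<close>; this restriction to the large
  rows and columns is what keeps the number of candidates per shell small.
\<close>

lemma expected_cut_le:
  fixes a :: "'a \<Rightarrow> 'b \<Rightarrow> real"
  assumes fin: "finite A" "finite B"
  defines "r \<equiv> \<lambda>i. sqrt (\<Sum>j\<in>B. (a i j)\<^sup>2)" and "c \<equiv> \<lambda>j. sqrt (\<Sum>i\<in>A. (a i j)\<^sup>2)"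
  obtains M where
    "\<And>\<theta> I J. I \<subseteq> A \<Longrightarrow> J \<subseteq> B \<Longrightarrow> \<bar>\<Sum>i\<in>I. \<Sum>j\<in>J. \<theta> (i, j) * a i j\<bar> \<le> M \<theta>"
    "sign_mean (A \<times> B) M \<le> 5 * ((\<Sum>i\<in>A. r i) + (\<Sum>j\<in>B. c j))"
proof -
  define P where "P = {(i, j)\<in>A \<times> B. a i j \<noteq> 0}"
  define level where "level = (\<lambda>(i, j). \<lfloor>log 2 (min (r i) (c j))\<rfloor>)"
  define K where "K = level ` P"
  define L where "L = (\<lambda>k. {e\<in>P. level e = k})"
  define R where "R = (\<lambda>k :: int. {i\<in>A. 2 powr k \<le> r i})"
  define C where "C = (\<lambda>k :: int. {j\<in>B. 2 powr k \<le> c j})"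
  define \<F> where "\<F> = (\<lambda>k. (\<lambda>(I, J). L k \<inter> I \<times> J) ` (Pow (R k) \<times> Pow (C k)))"
  define b where "b = (\<lambda>(i, j). a i j)"
  define M where "M = (\<lambda>\<theta>. \<Sum>k\<in>K. Max ((\<lambda>X. \<bar>sign_sum X b \<theta>\<bar>) ` \<F> k))"
  have finP: "finite P" unfolding P_def using fin by (auto intro: finite_subset[of _ "A \<times> B"])
  have finK: "finite K" unfolding K_def using finP by simp
  have r_nonneg: "r i \<ge> 0" for i unfolding r_def by (simp add: sum_nonneg)
  have c_nonneg: "c j \<ge> 0" for j unfolding c_def by (simp add: sum_nonneg)
  have P_pos: "r i > 0" "c j > 0" if "(i, j) \<in> P" for i j
  proof -
    have ij: "i \<in> A" "j \<in> B" "a i j \<noteq> 0" using that by (auto simp: P_def)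
    show "r i > 0"
      unfolding r_def real_sqrt_gt_0_iff using fin ij by (intro sum_pos2[of _ j]) auto
    show "c j > 0"
      unfolding c_def real_sqrt_gt_0_iff using fin ij by (intro sum_pos2[of _ i]) auto
  qed
  \<comment> \<open>The level is the binary order of magnitude of \<open>min (r i) (c j)\<close>.\<close>
  have level_le: "2 powr (level (i, j)) \<le> min (r i) (c j)"
    and level_gt: "min (r i) (c j) < 2 * 2 powr (level (i, j))" if "(i, j) \<in> P" for i j
  proof -
    define s where "s = min (r i) (c j)"
    have pos: "s > 0" using P_pos[OF that] by (simp add: s_def)
    have level: "level (i, j) = \<lfloor>log 2 s\<rfloor>" by (simp add: level_def s_def)
    have "2 powr (level (i, j)) \<le> 2 powr (log 2 s)"
      unfolding level by (intro powr_mono) auto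
    then show "2 powr (level (i, j)) \<le> min (r i) (c j)" using pos by (simp flip: s_def)
    have "2 powr (log 2 s) < 2 powr (real_of_int (level (i, j)) + 1)"
      unfolding level by (intro powr_less_mono) (simp_all add: real_of_int_floor_add_one_gt)
    then show "min (r i) (c j) < 2 * 2 powr (level (i, j))"
      using pos by (simp add: powr_add flip: s_def)
  qed
  have L_sub: "L k \<subseteq> R k \<times> C k" for k
  proof clarify
    fix i j assume "(i, j) \<in> L k"
    then show "i \<in> R k \<and> j \<in> C k"
      using level_le[of i j] by (auto simp: L_def R_def C_def P_def)
  qed
  have finRC: "finite (R k)" "finite (C k)" for k
    unfolding R_def C_def using fin by auto
  have sum_levels: "(\<Sum>e\<in>S. f e) = (\<Sum>k\<in>K. \<Sum>e\<in>{e\<in>S. level e = k}. f e)"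
    if "S \<subseteq> P" for S and f :: "'a \<times> 'b \<Rightarrow> real"
    using that finK finite_subset[OF that finP]
    by (intro sum.group[symmetric]) (auto simp: K_def)
  have bound: "\<bar>\<Sum>i\<in>I. \<Sum>j\<in>J. \<theta> (i, j) * a i j\<bar> \<le> M \<theta>" if "I \<subseteq> A" "J \<subseteq> B" for \<theta> I J
  proof -
    have finIJ: "finite I" "finite J" using that fin finite_subset by blast+
    have "(\<Sum>i\<in>I. \<Sum>j\<in>J. \<theta> (i, j) * a i j) = (\<Sum>e\<in>I \<times> J. \<theta> e * b e)"
      by (simp add: sum.cartesian_product b_def case_prod_beta)
    also have "\<dots> = (\<Sum>e\<in>P \<inter> I \<times> J. \<theta> e * b e)"
      using that finIJ by (intro sum.mono_neutral_right) (auto simp: P_def b_def)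
    also have "\<dots> = (\<Sum>k\<in>K. sign_sum {e\<in>P \<inter> I \<times> J. level e = k} b \<theta>)"
      unfolding sign_sum_def by (rule sum_levels) auto
    also have "\<bar>\<dots>\<bar> \<le> (\<Sum>k\<in>K. \<bar>sign_sum {e\<in>P \<inter> I \<times> J. level e = k} b \<theta>\<bar>)"
      by (rule sum_abs)
    also have "\<dots> \<le> M \<theta>"
      unfolding M_def
    proof (intro sum_mono Max_ge imageI)
      fix k
      show "finite ((\<lambda>X. \<bar>sign_sum X b \<theta>\<bar>) ` \<F> k)"
        using finRC by (simp add: \<F>_def)
      have "{e\<in>P \<inter> I \<times> J. level e = k} = L k \<inter> (I \<inter> R k) \<times> (J \<inter> C k)"
        using L_sub[of k] by (auto simp: L_def)
      then show "{e\<in>P \<inter> I \<times> J. level e = k} \<in> \<F> k"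
        by (auto simp: \<F>_def intro!: image_eqI[of _ _ "(I \<inter> R k, J \<inter> C k)"])
    qed
    finally show ?thesis .
  qed
  have shell: "sign_mean (A \<times> B) (\<lambda>\<theta>. Max ((\<lambda>X. \<bar>sign_sum X b \<theta>\<bar>) ` \<F> k))
      \<le> 2 * 2 powr k * (card (R k) + card (C k)) + (\<Sum>(i, j)\<in>L k. (a i j)\<^sup>2) / (2 * 2 powr k)"
    if "k \<in> K" for k
    unfolding \<F>_def b_def using that fin L_sub[of k]
    by (intro sign_mean_dyadic_shell_le) (auto simp: R_def C_def K_def L_def)
  have "sign_mean (A \<times> B) M = (\<Sum>k\<in>K. sign_mean (A \<times> B) (\<lambda>\<theta>. Max ((\<lambda>X. \<bar>sign_sum X b \<theta>\<bar>) ` \<F> k)))"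
    unfolding M_def by (rule sign_mean_sum)
  also have "\<dots> \<le> (\<Sum>k\<in>K. 2 * 2 powr k * (card (R k) + card (C k))
      + (\<Sum>(i, j)\<in>L k. (a i j)\<^sup>2) / (2 * 2 powr k))"
    by (intro sum_mono shell)
  also have "\<dots> = 2 * (\<Sum>k\<in>K. 2 powr k * card (R k)) + 2 * (\<Sum>k\<in>K. 2 powr k * card (C k))
      + (\<Sum>k\<in>K. (\<Sum>(i, j)\<in>L k. (a i j)\<^sup>2) / (2 * 2 powr k))"
    by (simp add: sum.distrib sum_distrib_left algebra_simps)
  also have "(\<Sum>k\<in>K. 2 powr k * card (R k)) \<le> 2 * (\<Sum>i\<in>A. r i)"
    unfolding R_def by (intro sum_geometric_cards_le fin finK r_nonneg)
  also have "(\<Sum>k\<in>K. 2 powr k * card (C k)) \<le> 2 * (\<Sum>j\<in>B. c j)"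
    unfolding C_def by (intro sum_geometric_cards_le fin finK c_nonneg)
  also have "(\<Sum>k\<in>K. (\<Sum>(i, j)\<in>L k. (a i j)\<^sup>2) / (2 * 2 powr k)) \<le> (\<Sum>i\<in>A. r i) + (\<Sum>j\<in>B. c j)"
  proof -
    have "(\<Sum>k\<in>K. (\<Sum>(i, j)\<in>L k. (a i j)\<^sup>2) / (2 * 2 powr k))
        = (\<Sum>k\<in>K. \<Sum>e\<in>{e\<in>P. level e = k}. (b e)\<^sup>2 / (2 * 2 powr (level e)))"
      by (intro sum.cong) (auto simp: L_def b_def sum_divide_distrib case_prod_beta intro!: sum.cong)
    also have "\<dots> = (\<Sum>e\<in>P. (b e)\<^sup>2 / (2 * 2 powr (level e)))"
      by (rule sum_levels[symmetric]) simp
    also have "\<dots> \<le> (\<Sum>(i, j)\<in>P. (a i j)\<^sup>2 / r i + (a i j)\<^sup>2 / c j)"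
    proof (intro sum_mono, clarify)
      fix i j assume ij: "(i, j) \<in> P"
      note pos = P_pos[OF ij]
      have "(a i j)\<^sup>2 / (2 * 2 powr (level (i, j))) \<le> (a i j)\<^sup>2 / min (r i) (c j)"
        using level_gt[OF ij] pos by (intro divide_left_mono) auto
      also have "\<dots> \<le> (a i j)\<^sup>2 / r i + (a i j)\<^sup>2 / c j"
        using pos by (cases "r i \<le> c j") (auto simp: min_def)
      finally show "(b (i, j))\<^sup>2 / (2 * 2 powr (level (i, j))) \<le> (a i j)\<^sup>2 / r i + (a i j)\<^sup>2 / c j"
        by (simp add: b_def)
    qed
    also have "\<dots> \<le> (\<Sum>(i, j)\<in>A \<times> B. (a i j)\<^sup>2 / r i + (a i j)\<^sup>2 / c j)"
      using fin r_nonneg c_nonneg by (intro sum_mono2) (auto simp: P_def)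
    also have "\<dots> = (\<Sum>i\<in>A. \<Sum>j\<in>B. (a i j)\<^sup>2 / r i) + (\<Sum>j\<in>B. \<Sum>i\<in>A. (a i j)\<^sup>2 / c j)"
      by (subst sum.swap[of _ A B]) (simp add: sum.distrib flip: sum.cartesian_product)
    also have "(\<Sum>i\<in>A. \<Sum>j\<in>B. (a i j)\<^sup>2 / r i) = (\<Sum>i\<in>A. r i)"
      by (simp add: r_def sum_nonneg real_div_sqrt flip: sum_divide_distrib)
    also have "(\<Sum>j\<in>B. \<Sum>i\<in>A. (a i j)\<^sup>2 / c j) = (\<Sum>j\<in>B. c j)"
      by (simp add: c_def sum_nonneg real_div_sqrt flip: sum_divide_distrib)
    finally show ?thesis .
  qed
  finally have "sign_mean (A \<times> B) M \<le> 5 * ((\<Sum>i\<in>A. r i) + (\<Sum>j\<in>B. c j))"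
    by (simp add: algebra_simps)
  with bound show ?thesis by (rule that)
qed

section \<open>The two-sided estimate\<close>

lemma expected_disc_eq_sign_mean:
  "expected_disc n m a = sign_mean ({1..n} \<times> {1..m}) (disc_col n m a)"
  by (simp add: expected_disc_eq_average sign_mean_def colorings_def card_cartesian_product)

lemma disc_le_expected_disc: "disc n m a \<le> expected_disc n m a"
proof -
  have "sign_mean ({1..n} \<times> {1..m}) (\<lambda>_. disc n m a) \<le> sign_mean ({1..n} \<times> {1..m}) (disc_col n m a)"
    unfolding disc_def
    by (intro sign_mean_mono Min_le imageI finite_imageI finite_colorings) (simp add: colorings_def)
  then show ?thesis by (simp add: expected_disc_eq_sign_mean)
qed

theorem theorem5:
  shows "\<exists>c C :: real. 0 < c \<and> c \<le> C \<and>
    (\<forall>(n :: nat) (m :: nat) (a :: nat \<Rightarrow> nat \<Rightarrow> real).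
      let Q = max (\<Sum>i=1..n. sqrt (\<Sum>j=1..m. (a i j)\<^sup>2)) (\<Sum>j=1..m. sqrt (\<Sum>i=1..n. (a i j)\<^sup>2))
      in c * Q \<le> disc n m a \<and> disc n m a \<le> C * Q \<and>
         c * Q \<le> expected_disc n m a \<and> expected_disc n m a \<le> C * Q)"
proof (rule exI[of _ "9 / 64"], rule exI[of _ 10], intro conjI allI)
  fix n m :: nat and a :: "nat \<Rightarrow> nat \<Rightarrow> real"
  define Q where "Q = max (\<Sum>i=1..n. sqrt (\<Sum>j=1..m. (a i j)\<^sup>2)) (\<Sum>j=1..m. sqrt (\<Sum>i=1..n. (a i j)\<^sup>2))"
  have lower: "9 / 64 * Q \<le> disc n m a"
    unfolding disc_def
  proof (rule Min.boundedI)
    fix x assume "x \<in> disc_col n m a ` colorings n m"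
    then show "9 / 64 * Q \<le> x"
      unfolding Q_def using disc_col_lower_bound by blast
  qed (simp_all add: finite_colorings colorings_nonempty)
  obtain M where M:
    "\<And>\<theta> I J. I \<subseteq> {1..n} \<Longrightarrow> J \<subseteq> {1..m} \<Longrightarrow> \<bar>\<Sum>i\<in>I. \<Sum>j\<in>J. \<theta> (i, j) * a i j\<bar> \<le> M \<theta>"
    "sign_mean ({1..n} \<times> {1..m}) M \<le> 5 * ((\<Sum>i=1..n. sqrt (\<Sum>j=1..m. (a i j)\<^sup>2))
      + (\<Sum>j=1..m. sqrt (\<Sum>i=1..n. (a i j)\<^sup>2)))"
    using expected_cut_le[of "{1..n}" "{1..m}" a] by auto
  have "expected_disc n m a \<le> sign_mean ({1..n} \<times> {1..m}) M"
    unfolding expected_disc_eq_sign_mean by (intro sign_mean_mono disc_col_le M(1))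
  also note M(2)
  also have "5 * ((\<Sum>i=1..n. sqrt (\<Sum>j=1..m. (a i j)\<^sup>2)) + (\<Sum>j=1..m. sqrt (\<Sum>i=1..n. (a i j)\<^sup>2))) \<le> 10 * Q"
    unfolding Q_def by simp
  finally have upper: "expected_disc n m a \<le> 10 * Q" .
  show "let Q = max (\<Sum>i=1..n. sqrt (\<Sum>j=1..m. (a i j)\<^sup>2)) (\<Sum>j=1..m. sqrt (\<Sum>i=1..n. (a i j)\<^sup>2))
      in 9 / 64 * Q \<le> disc n m a \<and> disc n m a \<le> 10 * Q \<and>
         9 / 64 * Q \<le> expected_disc n m a \<and> expected_disc n m a \<le> 10 * Q"
    unfolding Let_def Q_def[symmetric]
    using lower upper disc_le_expected_disc[of n m a] by linarith
qed auto

end
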